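(* Let $a$ and $\sigma$ be real numbers with $a<\sigma$, and let $R$ be a multiset of complex numbers $\rho$ such that (i) $2\sigma-a\notin R$; (ii) $\displaystyle\sum_{\rho\in R}\frac{1+|\operatorname{Re}\rho|}{1+|\rho+a-2\sigma|^2}<+\infty$. Then the following conditions are equivalent: (a) $\operatorname{Re}\rho\le\sigma$ for every $\rho\in R$; (b) $\displaystyle\sum_{\rho\in R}\operatorname{Re}\left(1-\left(\frac{\rho-a}{\rho-2\sigma+a}\right)^n\right)\ge 0$ for $n=1,2,3,\dots$; (c) for every fixed $\varepsilon>0$ there is a positive constant $c(\varepsilon)$ such that $$\sum_{\rho\in R}\operatorname{Re}\left(1-\left(\frac{\rho-a}{\rho-2\sigma+a}\right)^n\right)\ge -c(\varepsilon)e^{\varepsilon n},\qquad n=1,2,3,\dots$$ If instead $a>\sigma$ and the other conditions (i), (ii) are the same, then the following are equivalent: (a') $\operatorname{Re}\rho\ge\sigma$ for every $\rho\in R$; condition (b); condition (c).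
   Context: Sums over the multiset $R$ are taken with multiplicity: each element contributes as many times as its multiplicity in $R$. *)

theory Defs
  imports "HOL-Analysis.Analysis"
begin

text \<open>
  A multiset of complex numbers, possibly infinite, is given by its multiplicity function
  \<open>R :: complex \<Rightarrow> nat\<close>: the element \<open>\<rho>\<close> occurs \<open>R \<rho>\<close> times. (The library type of multisets
  admits finite multisets only.) Infinite multiplicities are not representable; this loses
  nothing when a sum of strictly positive terms over the multiset is assumed to converge.
\<close>

type_synonym complex_mset = "complex \<Rightarrow> nat"

definition elems_of :: "complex_mset \<Rightarrow> complex set" where
  "elems_of R = {\<rho>. R \<rho> \<noteq> 0}"

definition msummable :: "complex_mset \<Rightarrow> (complex \<Rightarrow> real) \<Rightarrow> bool" where
  "msummable R f \<longleftrightarrow> (\<lambda>\<rho>. real (R \<rho>) * f \<rho>) summable_on elems_of R"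

definition msum :: "complex_mset \<Rightarrow> (complex \<Rightarrow> real) \<Rightarrow> real" where
  "msum R f = (\<Sum>\<^sub>\<infinity>\<rho>\<in>elems_of R. real (R \<rho>) * f \<rho>)"

definition li_sum :: "real \<Rightarrow> real \<Rightarrow> complex_mset \<Rightarrow> nat \<Rightarrow> real" where
  "li_sum a \<sigma> R n =
     msum R (\<lambda>\<rho>. Re (1 - ((\<rho> - of_real a) / (\<rho> - of_real (2 * \<sigma>) + of_real a)) ^ n))"

text \<open>
  A divergent \<open>infsum\<close> has the default value \<open>0\<close>. The lemma \<open>li_sum_summable\<close> shows that this
  case does not arise for \<open>li_sum\<close> once
  \<open>\<Sum> (1 + \<bar>Re \<rho>\<bar>) / (1 + \<bar>\<rho> + a - 2 \<sigma>\<bar>\<^sup>2)\<close> converges over \<open>R\<close>.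
\<close>

lemma binomial_remainder:
  fixes K :: real
  assumes "K \<ge> 0"
  shows "\<exists>C\<ge>0. \<forall>x::complex. cmod x \<le> K \<longrightarrow> cmod ((1 + x) ^ n - 1 - of_nat n * x) \<le> C * (cmod x)\<^sup>2"
proof (induction n)
  case 0
  show ?case by (auto intro!: exI[of _ 0])
next
  case (Suc n)
  then obtain C where C: "C \<ge> 0"
    "\<And>x::complex. cmod x \<le> K \<Longrightarrow> cmod ((1 + x) ^ n - 1 - of_nat n * x) \<le> C * (cmod x)\<^sup>2"
    by blast
  show ?case
  proof (intro exI[of _ "(1 + K) * C + real n"] conjI allI impI)
    show "0 \<le> (1 + K) * C + real n" using C(1) assms by simp
    fix x :: complex assume x: "cmod x \<le> K"
    have "(1 + x) ^ Suc n - 1 - of_nat (Suc n) * x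
        = (1 + x) * ((1 + x) ^ n - 1 - of_nat n * x) + of_nat n * x\<^sup>2"
      by (simp add: algebra_simps power2_eq_square)
    also have "cmod \<dots> \<le> cmod (1 + x) * cmod ((1 + x) ^ n - 1 - of_nat n * x) + real n * (cmod x)\<^sup>2"
      by (rule order_trans[OF norm_triangle_ineq]) (simp add: norm_mult norm_power)
    also have "\<dots> \<le> (1 + K) * (C * (cmod x)\<^sup>2) + real n * (cmod x)\<^sup>2"
    proof -
      have "cmod (1 + x) \<le> 1 + K"
        using norm_triangle_ineq[of 1 x] x by simp
      then show ?thesis
        using C(2)[OF x] assms by (intro add_mono mult_mono) auto
    qed
    finally show "cmod ((1 + x) ^ Suc n - 1 - of_nat (Suc n) * x) \<le> ((1 + K) * C + real n) * (cmod x)\<^sup>2"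
      by (simp add: algebra_simps)
  qed
qed

lemma li_sum_summable:
  fixes a \<sigma> :: real and R :: complex_mset
  assumes ii: "msummable R (\<lambda>\<rho>. (1 + \<bar>Re \<rho>\<bar>) / (1 + (cmod (\<rho> + of_real a - of_real (2 * \<sigma>)))\<^sup>2))"
  shows "msummable R (\<lambda>\<rho>. Re (1 - ((\<rho> - of_real a) / (\<rho> - of_real (2 * \<sigma>) + of_real a)) ^ n))"
proof -
  define w where "w = 2 * \<sigma> - a"
  define K where "K = 2 * \<sigma> - 2 * a"
  define h where "h = (\<lambda>\<rho>. (1 + \<bar>Re \<rho>\<bar>) / (1 + (cmod (\<rho> - of_real w))\<^sup>2))"
  define g where "g = (\<lambda>\<rho>. Re (1 - ((\<rho> - of_real a) / (\<rho> - of_real w)) ^ n))"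
  define S where "S = elems_of R"
  define F where "F = {\<rho>\<in>S. cmod (\<rho> - of_real w) < 1}"
  have sh: "(\<lambda>\<rho>. real (R \<rho>) * h \<rho>) summable_on S"
  proof -
    have "\<rho> + of_real a - of_real (2 * \<sigma>) = \<rho> - of_real w" for \<rho> :: complex
      by (simp add: w_def)
    then show ?thesis using ii unfolding msummable_def S_def h_def by (simp only:)
  qed
  have h0: "h \<rho> \<ge> 0" for \<rho> by (simp add: h_def)
  have finF: "finite F"
  proof -
    define B where "B = infsum (\<lambda>\<rho>. real (R \<rho>) * h \<rho>) S"
    have "card G \<le> nat \<lceil>2 * B\<rceil>" if G: "finite G" "G \<subseteq> F" for G
    proof -
      have "real (card G) * (1/2) = (\<Sum>\<rho>\<in>G. 1/2)" by simp
      also have "\<dots> \<le> (\<Sum>\<rho>\<in>G. real (R \<rho>) * h \<rho>)"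
      proof (rule sum_mono)
        fix \<rho> assume "\<rho> \<in> G"
        then have r: "R \<rho> \<noteq> 0" "cmod (\<rho> - of_real w) < 1"
          using G by (auto simp: F_def S_def elems_of_def)
        then have "(cmod (\<rho> - of_real w))\<^sup>2 \<le> 1" by (simp add: power_le_one)
        then have "1/2 \<le> h \<rho>"
          by (auto simp: h_def divide_simps add_pos_nonneg intro: add_mono)
        moreover have "1 \<le> real (R \<rho>)" using r by simp
        ultimately show "1/2 \<le> real (R \<rho>) * h \<rho>"
          using mult_mono[of 1 "real (R \<rho>)" "1/2" "h \<rho>"] by simp
      qed
      also have "\<dots> \<le> B"
        unfolding B_def using G h0 sh
        by (intro finite_sum_le_infsum) (auto simp: F_def)
      finally show ?thesis by linarith
    qed
    then have "finite F \<and> card F \<le> nat \<lceil>2 * B\<rceil>"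
      by (intro finite_if_finite_subsets_card_bdd) auto
    then show ?thesis ..
  qed
  obtain C where C: "C \<ge> 0"
    "\<And>x::complex. cmod x \<le> \<bar>K\<bar> \<Longrightarrow> cmod ((1 + x) ^ n - 1 - of_nat n * x) \<le> C * (cmod x)\<^sup>2"
    using binomial_remainder[of "\<bar>K\<bar>" n] by auto
  define D where "D = 2 * (real n * \<bar>K\<bar> * (1 + \<bar>w\<bar>) + C * K\<^sup>2)"
  have bound: "norm (real (R \<rho>) * g \<rho>) \<le> D * (real (R \<rho>) * h \<rho>)" if "\<rho> \<in> S - F" for \<rho>
  proof -
    define z where "z = \<rho> - of_real w"
    define x where "x = of_real K / z"
    have z1: "cmod z \<ge> 1" using that by (auto simp: F_def z_def)
    then have z0: "z \<noteq> 0" by auto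
    have zsq: "(cmod z)\<^sup>2 \<ge> 1" using z1 by (simp add: one_le_power)
    have "(\<rho> - of_real a) / (\<rho> - of_real w) = 1 + x"
      using z0 by (simp add: x_def z_def K_def w_def field_simps)
    then have geq: "g \<rho> = - real n * Re x - Re ((1 + x) ^ n - 1 - of_nat n * x)"
      by (simp add: g_def)
    have nx: "cmod x = \<bar>K\<bar> / cmod z" by (simp add: x_def norm_divide)
    have "cmod x \<le> \<bar>K\<bar>" unfolding nx using z1 by (simp add: divide_le_eq mult_le_cancel_left1 z0)
    from C(2)[OF this] have e1: "\<bar>Re ((1 + x) ^ n - 1 - of_nat n * x)\<bar> \<le> C * (K\<^sup>2 / (cmod z)\<^sup>2)"
      using abs_Re_le_cmod[of "(1 + x) ^ n - 1 - of_nat n * x"]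
      unfolding nx by (simp add: power_divide)
    have "Re x = K * Re z / (cmod z)\<^sup>2"
      by (simp add: x_def Re_divide cmod_power2)
    then have "\<bar>Re x\<bar> = \<bar>K\<bar> * \<bar>Re z\<bar> / (cmod z)\<^sup>2"
      by (simp add: abs_mult)
    also have "\<dots> \<le> \<bar>K\<bar> * ((1 + \<bar>w\<bar>) * (1 + \<bar>Re \<rho>\<bar>)) / (cmod z)\<^sup>2"
    proof -
      have "\<bar>Re z\<bar> \<le> \<bar>Re \<rho>\<bar> + \<bar>w\<bar>" by (simp add: z_def)
      also have "\<dots> \<le> (1 + \<bar>w\<bar>) * (1 + \<bar>Re \<rho>\<bar>)" by (simp add: algebra_simps)
      finally show ?thesis by (intro divide_right_mono mult_left_mono) auto
    qed
    finally have e2: "\<bar>Re x\<bar> \<le> \<bar>K\<bar> * ((1 + \<bar>w\<bar>) * (1 + \<bar>Re \<rho>\<bar>)) / (cmod z)\<^sup>2" .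
    have "\<bar>g \<rho>\<bar> \<le> real n * \<bar>Re x\<bar> + \<bar>Re ((1 + x) ^ n - 1 - of_nat n * x)\<bar>"
      unfolding geq by (rule order_trans[OF abs_triangle_ineq4]) (simp add: abs_mult)
    also have "\<dots> \<le> real n * (\<bar>K\<bar> * ((1 + \<bar>w\<bar>) * (1 + \<bar>Re \<rho>\<bar>)) / (cmod z)\<^sup>2)
                    + C * (K\<^sup>2 * (1 + \<bar>Re \<rho>\<bar>) / (cmod z)\<^sup>2)"
    proof -
      have "K\<^sup>2 / (cmod z)\<^sup>2 \<le> K\<^sup>2 * (1 + \<bar>Re \<rho>\<bar>) / (cmod z)\<^sup>2"
        by (intro divide_right_mono) (auto simp: algebra_simps)
      then have "C * (K\<^sup>2 / (cmod z)\<^sup>2) \<le> C * (K\<^sup>2 * (1 + \<bar>Re \<rho>\<bar>) / (cmod z)\<^sup>2)"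
        using C(1) by (rule mult_left_mono)
      then show ?thesis using e1 e2 by (intro add_mono mult_left_mono) auto
    qed
    also have "\<dots> = D / 2 * ((1 + \<bar>Re \<rho>\<bar>) / (cmod z)\<^sup>2)"
      by (simp add: D_def algebra_simps add_divide_distrib)
    also have "\<dots> \<le> D / 2 * (2 * h \<rho>)"
    proof (rule mult_left_mono)
      show "0 \<le> D / 2" using C(1) by (simp add: D_def)
      have "(1 + \<bar>Re \<rho>\<bar>) / (cmod z)\<^sup>2 \<le> (1 + \<bar>Re \<rho>\<bar>) / ((1 + (cmod z)\<^sup>2) / 2)"
        using zsq by (intro divide_left_mono) (auto intro!: mult_pos_pos add_pos_nonneg z0)
      then show "(1 + \<bar>Re \<rho>\<bar>) / (cmod z)\<^sup>2 \<le> 2 * h \<rho>"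
        by (simp add: h_def z_def mult.commute)
    qed
    finally have "\<bar>g \<rho>\<bar> \<le> D * h \<rho>" by simp
    then have "real (R \<rho>) * \<bar>g \<rho>\<bar> \<le> real (R \<rho>) * (D * h \<rho>)" by (rule mult_left_mono) simp
    then show ?thesis by (simp add: abs_mult mult_ac)
  qed
  have "(\<lambda>\<rho>. real (R \<rho>) * h \<rho>) summable_on (S - F)"
    using sh by (rule summable_on_subset_banach) auto
  then have "(\<lambda>\<rho>. D * (real (R \<rho>) * h \<rho>)) summable_on (S - F)"
    by (rule summable_on_cmult_right)
  then have "(\<lambda>\<rho>. norm (real (R \<rho>) * g \<rho>)) summable_on (S - F)"
    by (rule summable_on_comparison_test) (use bound in auto)
  then have "(\<lambda>\<rho>. real (R \<rho>) * g \<rho>) summable_on (S - F)"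
    by (rule abs_summable_summable)
  then have "(\<lambda>\<rho>. real (R \<rho>) * g \<rho>) summable_on ((S - F) \<union> F)"
    by (rule summable_on_Un_disjoint) (use finF in auto)
  moreover have "(S - F) \<union> F = S" by (auto simp: F_def)
  moreover have "\<rho> - of_real (2 * \<sigma>) + of_real a = \<rho> - of_real w" for \<rho> :: complex
    by (simp add: w_def)
  ultimately show ?thesis
    unfolding msummable_def S_def g_def by (simp only:)
qed

end

theory Submission
  imports Defs
begin

text \<open>
  The map \<open>\<rho> \<mapsto> (\<rho> - a) / (\<rho> - 2 \<sigma> + a)\<close> compares the distances of \<open>\<rho>\<close> to \<open>a\<close> and to
  \<open>2 \<sigma> - a\<close>, two points that are mirror images in the line \<open>Re \<rho> = \<sigma>\<close>. Hence it sends the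
  closed half plane on the side of \<open>a\<close> to the closed unit disc, and both parts of the theorem
  become one statement about the images \<open>q\<close>: all of them satisfy \<open>\<bar>q\<bar> \<le> 1\<close> iff the sums of
  \<open>Re (1 - q ^ n)\<close> are nonnegative, iff they are not exponentially negative. If \<open>\<bar>q\<bar> \<le> 1\<close>
  always, then every term is nonnegative; only the way back from the exponential bound needs work.

  Write \<open>q = 1 + x\<close>. The convergence hypothesis says that \<open>\<bar>Re x\<bar> + \<bar>x\<bar>\<^sup>2\<close> has a finite sum.
  Therefore \<open>x\<close> tends to \<open>0\<close> along the family, and if some \<open>\<bar>q\<bar>\<close> exceeds \<open>1\<close>, then the largest
  modulus \<open>M\<close> is attained, at finitely many members only, while all the others stay below some
  \<open>r < M\<close> with \<open>r > 1\<close> (\<open>max_modulus_gap\<close>). The others contribute at most a constant times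
  \<open>n\<^sup>2 r ^ n\<close> in absolute value (\<open>abs_Re_one_minus_power_le\<close>). By simultaneous Diophantine
  approximation, for arbitrarily large \<open>n\<close> all the powers \<open>q ^ n\<close> with \<open>\<bar>q\<bar> = M\<close> point almost
  in the direction of the positive real axis (\<open>simultaneous_powers_near_positive_axis\<close>). For those
  \<open>n\<close> the sum is below \<open>- const * M ^ n\<close>, which contradicts the lower bound \<open>- c * r ^ n\<close>
  (\<open>norm_le_1_if_li_lower_bound\<close>).
\<close>

section \<open>Growth of a single term\<close>

text \<open>
  The dependence on \<open>n\<close> and \<open>r\<close> is explicit because these terms will have to lose against \<open>M ^ n\<close>
  for every \<open>M > r\<close>.
\<close>

lemma norm_power_minus_linear_le:
  fixes x :: complex
  assumes "r \<ge> 1" and "cmod (1 + x) \<le> r"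
  shows "cmod ((1 + x) ^ n - 1 - of_nat n * x) \<le> (real n)\<^sup>2 * r ^ n * (cmod x)\<^sup>2"
proof (induction n)
  case 0
  show ?case by simp
next
  case (Suc n)
  have "(1 + x) ^ Suc n - 1 - of_nat (Suc n) * x
      = (1 + x) * ((1 + x) ^ n - 1 - of_nat n * x) + of_nat n * x\<^sup>2"
    by (simp add: algebra_simps power2_eq_square)
  also have "cmod \<dots> \<le> cmod (1 + x) * cmod ((1 + x) ^ n - 1 - of_nat n * x) + real n * (cmod x)\<^sup>2"
    by (rule order_trans[OF norm_triangle_ineq]) (simp add: norm_mult norm_power)
  also have "\<dots> \<le> r * ((real n)\<^sup>2 * r ^ n * (cmod x)\<^sup>2) + (real n * r ^ Suc n) * (cmod x)\<^sup>2"
  proof -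
    have "real n * 1 \<le> real n * r ^ Suc n"
      using assms(1) by (intro mult_left_mono one_le_power) auto
    then show ?thesis
      using Suc.IH assms by (intro add_mono mult_mono mult_right_mono) auto
  qed
  also have "\<dots> = ((real n)\<^sup>2 + real n) * (r ^ Suc n * (cmod x)\<^sup>2)"
    by (simp add: algebra_simps)
  also have "\<dots> \<le> (real (Suc n))\<^sup>2 * (r ^ Suc n * (cmod x)\<^sup>2)"
    using assms(1) by (intro mult_right_mono) (auto simp: power2_eq_square algebra_simps)
  finally show ?case by (simp add: mult_ac)
qed

text \<open>
  The linear term \<open>n x\<close> enters through its real part only. This is what makes the series over
  the family converge although \<open>\<bar>x\<bar>\<close> itself need not be summable.
\<close>

lemma abs_Re_one_minus_power_le:
  fixes x :: complex
  assumes "r \<ge> 1" and "cmod (1 + x) \<le> r"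
  shows "\<bar>Re (1 - (1 + x) ^ n)\<bar> \<le> (real n)\<^sup>2 * r ^ n * (\<bar>Re x\<bar> + (cmod x)\<^sup>2)"
proof -
  define e where "e = (1 + x) ^ n - 1 - of_nat n * x"
  have "Re (1 - (1 + x) ^ n) = - (real n * Re x) - Re e"
    by (simp add: e_def)
  then have "\<bar>Re (1 - (1 + x) ^ n)\<bar> \<le> real n * \<bar>Re x\<bar> + cmod e"
    using abs_Re_le_cmod[of e] abs_mult[of "real n" "Re x"] by simp
  also have "\<dots> \<le> (real n)\<^sup>2 * r ^ n * \<bar>Re x\<bar> + (real n)\<^sup>2 * r ^ n * (cmod x)\<^sup>2"
  proof (rule add_mono)
    have "real n * 1 \<le> (real n)\<^sup>2 * r ^ n"
      using assms(1) self_le_power[of "real n" 2]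
      by (intro mult_mono one_le_power) (cases n; auto)+
    then show "real n * \<bar>Re x\<bar> \<le> (real n)\<^sup>2 * r ^ n * \<bar>Re x\<bar>"
      by (intro mult_right_mono) auto
  qed (use norm_power_minus_linear_le[OF assms] in \<open>simp add: e_def\<close>)
  finally show ?thesis by (simp add: algebra_simps)
qed

section \<open>Simultaneous recurrence of powers\<close>

lemma cos_ge_half:
  assumes "\<bar>t\<bar> \<le> pi / 3"
  shows "cos t \<ge> 1 / 2"
proof -
  have "cos (pi / 3) \<le> cos \<bar>t\<bar>"
    using assms by (intro cos_monotone_0_pi_le) auto
  then show ?thesis by (simp add: cos_60)
qed

text \<open>
  The arguments of the \<open>z\<close>, divided by \<open>2 \<pi>\<close>, are approximated simultaneously by rationals with a
  common denominator. Approximating \<open>L\<close> times these numbers instead makes the resulting exponent a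
  multiple of \<open>L\<close>, hence large.
\<close>

lemma simultaneous_powers_near_positive_axis:
  fixes Z :: "complex set"
  assumes "finite Z"
  obtains n where "n \<ge> L" and "\<And>z. z \<in> Z \<Longrightarrow> Re (z ^ n) \<ge> cmod z ^ n / 2"
proof -
  define L' where "L' = max 1 L"
  obtain f where f: "bij_betw f {..<card Z} Z"
    using ex_bij_betw_nat_finite[OF assms] by (auto simp: atLeast0LessThan)
  define \<theta> where "\<theta> = (\<lambda>i. real L' * Arg (f i) / (2 * pi))"
  obtain q p where q: "0 < q"
    and qp: "\<And>i. i < card Z \<Longrightarrow> \<bar>of_int q * \<theta> i - of_int (p i)\<bar> < 1 / real (6::nat)"
    using Dirichlet_approx_simult[where N = 6 and \<theta> = \<theta> and n = "card Z"]
    by (metis zero_less_numeral)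
  define n where "n = nat q * L'"
  have n: "real n = of_int q * real L'"
    using q by (simp add: n_def)
  have "n \<ge> L' * 1"
    using q unfolding n_def by (subst mult.commute) (intro mult_le_mono; simp)
  then have "n \<ge> L"
    by (simp add: L'_def)
  moreover have "Re (z ^ n) \<ge> cmod z ^ n / 2" if "z \<in> Z" for z
  proof -
    obtain i where i: "i < card Z" "f i = z"
      using f \<open>z \<in> Z\<close> unfolding bij_betw_def by (metis imageE lessThan_iff)
    define t where "t = of_int q * \<theta> i - of_int (p i)"
    have "real n * Arg z = 2 * pi * of_int (p i) + 2 * pi * t"
      by (simp add: t_def \<theta>_def i n field_simps)
    then have "cos (real n * Arg z) = cos (2 * pi * t)"
      by (simp add: cos_add)
    moreover have "cos (2 * pi * t) \<ge> 1 / 2"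
    proof (rule cos_ge_half)
      have "2 * pi * \<bar>t\<bar> \<le> 2 * pi * (1 / 6)"
        using qp[OF i(1)] by (intro mult_left_mono) (auto simp: t_def)
      then show "\<bar>2 * pi * t\<bar> \<le> pi / 3"
        by (simp add: abs_mult)
    qed
    moreover have "Re (z ^ n) = cmod z ^ n * cos (real n * Arg z)"
    proof -
      have "z ^ n = rcis (cmod z) (Arg z) ^ n"
        by (simp add: rcis_cmod_Arg)
      then show ?thesis
        by (simp add: DeMoivre2)
    qed
    ultimately show ?thesis
      using mult_left_mono[of "1 / 2" "cos (real n * Arg z)" "cmod z ^ n"] by simp
  qed
  ultimately show thesis
    using that by blast
qed

section \<open>Summable families\<close>

lemma finite_if_summable_on_bounded_below:
  fixes f :: "'a \<Rightarrow> real"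
  assumes "f summable_on S" and "\<And>s. s \<in> S \<Longrightarrow> f s \<ge> 0" and "\<delta> > 0"
  shows "finite {s\<in>S. f s \<ge> \<delta>}"
proof -
  define B where "B = infsum f S / \<delta>"
  have "card G \<le> nat \<lfloor>B\<rfloor>" if G: "finite G" "G \<subseteq> {s\<in>S. f s \<ge> \<delta>}" for G
  proof -
    have "real (card G) * \<delta> \<le> sum f G"
      using G by (intro sum_bounded_below) auto
    also have "\<dots> \<le> infsum f S"
      using G assms by (intro finite_sum_le_infsum) auto
    finally have "real (card G) \<le> B"
      using assms(3) by (simp add: B_def field_simps)
    then show ?thesis by linarith
  qed
  then have "finite {s\<in>S. f s \<ge> \<delta>} \<and> card {s\<in>S. f s \<ge> \<delta>} \<le> nat \<lfloor>B\<rfloor>"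
    by (intro finite_if_finite_subsets_card_bdd) auto
  then show ?thesis ..
qed

text \<open>
  The moduli can accumulate only in \<open>[0, 1]\<close>, so as soon as one of them exceeds \<open>1\<close>, a finite
  subfamily of largest modulus is separated from all the rest.
\<close>

lemma max_modulus_gap:
  fixes f :: "'a \<Rightarrow> complex"
  assumes fin: "\<And>\<delta>. \<delta> > 0 \<Longrightarrow> finite {s\<in>S. cmod (f s) \<ge> 1 + \<delta>}"
    and s0: "s\<^sub>0 \<in> S" "cmod (f s\<^sub>0) > 1"
  obtains r M where "1 < r" "r < M"
    and "finite {s\<in>S. cmod (f s) = M}" and "{s\<in>S. cmod (f s) = M} \<noteq> {}"
    and "\<And>s. s \<in> S \<Longrightarrow> cmod (f s) \<noteq> M \<Longrightarrow> cmod (f s) \<le> r"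
proof -
  define T where "T = {s\<in>S. cmod (f s) \<ge> cmod (f s\<^sub>0)}"
  define M where "M = Max ((\<lambda>s. cmod (f s)) ` T)"
  have finT: "finite T"
    using fin[of "cmod (f s\<^sub>0) - 1"] s0 by (simp add: T_def)
  have s0T: "s\<^sub>0 \<in> T" by (simp add: T_def s0)
  have "M \<in> (\<lambda>s. cmod (f s)) ` T"
    unfolding M_def using finT s0T by (intro Max_in) auto
  then obtain s1 where s1: "s1 \<in> S" "cmod (f s1) = M" "M \<ge> cmod (f s\<^sub>0)"
    by (auto simp: T_def)
  have M1: "M > 1" using s1 s0 by linarith
  have le_M: "cmod (f s) \<le> M" if "s \<in> S" for s
  proof (cases "s \<in> T")
    case True
    then show ?thesis unfolding M_def using finT by (intro Max_ge) auto
  next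
    case False
    then show ?thesis using that s1 by (auto simp: T_def)
  qed
  \<comment> \<open>Only finitely many moduli lie above a number \<open>\<mu>\<close> between \<open>1\<close> and \<open>M\<close>,
      so those different from \<open>M\<close> stay below a maximum less than \<open>M\<close>.\<close>
  obtain \<mu> where \<mu>: "1 < \<mu>" "\<mu> < M"
    using dense[OF M1] by blast
  define U where "U = {s\<in>S. cmod (f s) \<ge> \<mu>}"
  have finU: "finite U"
    using fin[of "\<mu> - 1"] \<mu> by (simp add: U_def)
  define V where "V = insert \<mu> ((\<lambda>s. cmod (f s)) ` {s\<in>U. cmod (f s) \<noteq> M})"
  have finV: "finite V" using finU by (simp add: V_def)
  have "Max V \<in> V" by (rule Max_in) (use finV in \<open>auto simp: V_def\<close>)
  moreover have "v < M" if "v \<in> V" for v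
    using that \<mu> by (auto simp: V_def U_def order.not_eq_order_implies_strict le_M)
  ultimately have "Max V < M"
    by blast
  have Max_ge_\<mu>: "\<mu> \<le> Max V"
    by (rule Max_ge) (use finV in \<open>auto simp: V_def\<close>)
  show thesis
  proof (rule that)
    show "1 < Max V" using \<mu>(1) Max_ge_\<mu> by (rule less_le_trans)
    show "Max V < M" by fact
    show "finite {s\<in>S. cmod (f s) = M}"
      by (rule finite_subset[OF _ finU]) (use \<mu> in \<open>auto simp: U_def\<close>)
    show "{s\<in>S. cmod (f s) = M} \<noteq> {}" using s1 by auto
    show "cmod (f s) \<le> Max V" if "s \<in> S" "cmod (f s) \<noteq> M" for s
    proof (cases "s \<in> U")
      case True
      then show ?thesis using that finV by (intro Max_ge) (auto simp: V_def)
    next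
      case False
      then show ?thesis using that Max_ge_\<mu> by (auto simp: U_def)
    qed
  qed
qed

section \<open>The growth criterion for a family near 1\<close>

lemma eventually_exponential_dominates:
  fixes A B W r M :: real
  assumes "1 < r" "r < M" "W > 0"
  shows "eventually (\<lambda>n. W + (A * (real n)\<^sup>2 + B) * r ^ n < W * M ^ n / 2) sequentially"
proof -
  have pos: "r > 0" "M > 0" using assms by auto
  \<comment> \<open>The square root turns \<open>n\<^sup>2 (r / M) ^ n\<close> into the square of \<open>n t ^ n\<close>, which is a null sequence.\<close>
  define t where "t = sqrt (r / M)"
  have t: "0 \<le> t" "t < 1" using assms by (auto simp: t_def)
  have t2: "(t ^ n)\<^sup>2 = r ^ n / M ^ n" for n
  proof -
    have "(t ^ n)\<^sup>2 = (t\<^sup>2) ^ n"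
      by (simp add: mult.commute flip: power_mult)
    then show ?thesis
      using pos by (simp add: t_def power_divide)
  qed
  have "(\<lambda>n. W * (inverse M) ^ n + A * (real n * t ^ n)\<^sup>2 + B * (t ^ n)\<^sup>2)
      \<longlonglongrightarrow> W * 0 + A * 0\<^sup>2 + B * 0\<^sup>2"
    using t assms by (intro tendsto_intros powser_times_n_limit_0 LIMSEQ_power_zero)
      (auto simp: field_simps)
  then have "eventually (\<lambda>n. W * (inverse M) ^ n + A * (real n * t ^ n)\<^sup>2 + B * (t ^ n)\<^sup>2 < W / 2)
      sequentially"
    using assms by (intro order_tendstoD(2)) auto
  then show ?thesis
  proof eventually_elim
    case (elim n)
    have "W + (A * (real n)\<^sup>2 + B) * r ^ n
        = (W * (inverse M) ^ n + A * (real n * t ^ n)\<^sup>2 + B * (t ^ n)\<^sup>2) * M ^ n"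
      using pos by (simp add: power_mult_distrib t2 field_simps)
    also have "\<dots> < W / 2 * M ^ n"
      using elim pos by (intro mult_strict_right_mono) auto
    finally show ?case by simp
  qed
qed

lemma norm_le_1_if_li_lower_bound:
  fixes m :: "'a \<Rightarrow> real" and x :: "'a \<Rightarrow> complex"
  assumes m: "\<And>s. s \<in> S \<Longrightarrow> m s \<ge> 1"
    and summ: "(\<lambda>s. m s * (\<bar>Re (x s)\<bar> + (cmod (x s))\<^sup>2)) summable_on S"
    and summ_term: "\<And>n. (\<lambda>s. m s * Re (1 - (1 + x s) ^ n)) summable_on S"
    and lower: "\<And>\<epsilon>. \<epsilon> > 0 \<Longrightarrow>
      \<exists>c>0. \<forall>n\<ge>1. (\<Sum>\<^sub>\<infinity>s\<in>S. m s * Re (1 - (1 + x s) ^ n)) \<ge> - c * exp (\<epsilon> * real n)"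
    and "s\<^sub>0 \<in> S"
  shows "cmod (1 + x s\<^sub>0) \<le> 1"
proof (rule ccontr)
  assume "\<not> cmod (1 + x s\<^sub>0) \<le> 1"
  then have large: "cmod (1 + x s\<^sub>0) > 1" by simp
  define g where "g = (\<lambda>n s. m s * Re (1 - (1 + x s) ^ n))"
  define k where "k = (\<lambda>s. m s * (\<bar>Re (x s)\<bar> + (cmod (x s))\<^sup>2))"
  have k0: "k s \<ge> 0" if "s \<in> S" for s
    using m[OF that] by (simp add: k_def)
  have fin: "finite {s\<in>S. cmod (1 + x s) \<ge> 1 + \<delta>}" if "\<delta> > 0" for \<delta>
  proof (rule finite_subset)
    show "finite {s\<in>S. k s \<ge> \<delta>\<^sup>2}"
      using summ k0 that by (intro finite_if_summable_on_bounded_below) (auto simp: k_def)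
    show "{s\<in>S. cmod (1 + x s) \<ge> 1 + \<delta>} \<subseteq> {s\<in>S. k s \<ge> \<delta>\<^sup>2}"
    proof safe
      fix s assume s: "s \<in> S" "cmod (1 + x s) \<ge> 1 + \<delta>"
      then have "\<delta> \<le> cmod (x s)"
        using norm_triangle_ineq[of 1 "x s"] by simp
      then have "\<delta>\<^sup>2 \<le> (cmod (x s))\<^sup>2"
        using that by (intro power_mono) auto
      then have "1 * \<delta>\<^sup>2 \<le> k s"
        unfolding k_def using m[OF s(1)] by (intro mult_mono) auto
      then show "\<delta>\<^sup>2 \<le> k s" by simp
    qed
  qed
  obtain r M where Mr: "1 < r" "r < M"
    and finP: "finite {s\<in>S. cmod (1 + x s) = M}" and neP: "{s\<in>S. cmod (1 + x s) = M} \<noteq> {}"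
    and rest: "\<And>s. s \<in> S \<Longrightarrow> cmod (1 + x s) \<noteq> M \<Longrightarrow> cmod (1 + x s) \<le> r"
  proof (rule max_modulus_gap[of S "\<lambda>s. 1 + x s", OF _ \<open>s\<^sub>0 \<in> S\<close> large])
    show "finite {s\<in>S. cmod (1 + x s) \<ge> 1 + \<delta>}" if "\<delta> > 0" for \<delta>
      using that by (rule fin)
  qed (rule that)
  define P where "P = {s\<in>S. cmod (1 + x s) = M}"
  define W where "W = sum m P"
  define A where "A = infsum k (S - P)"
  have W: "W > 0"
    unfolding W_def using finP neP m
    by (intro sum_pos) (force simp: P_def intro: less_le_trans[OF zero_less_one])+
  have gS: "g n summable_on S" for n
    using summ_term by (simp add: g_def)
  have gR: "g n summable_on (S - P)" for n
    using gS by (rule summable_on_subset_banach) auto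
  have kR: "k summable_on (S - P)"
    using summ unfolding k_def by (rule summable_on_subset_banach) auto
  have split: "infsum (g n) S = sum (g n) P + infsum (g n) (S - P)" for n
  proof -
    have "infsum (g n) (P \<union> (S - P)) = infsum (g n) P + infsum (g n) (S - P)"
      using finP gR by (intro infsum_Un_disjoint) (auto simp: P_def)
    moreover have "P \<union> (S - P) = S" by (auto simp: P_def)
    ultimately show ?thesis using finP by (simp add: P_def)
  qed
  have tail: "infsum (g n) (S - P) \<le> A * (real n)\<^sup>2 * r ^ n" for n
  proof -
    have "infsum (g n) (S - P) \<le> infsum (\<lambda>s. (real n)\<^sup>2 * r ^ n * k s) (S - P)"
    proof (rule infsum_mono[OF gR summable_on_cmult_right[OF kR]])
      fix s assume s: "s \<in> S - P"
      then have "Re (1 - (1 + x s) ^ n) \<le> (real n)\<^sup>2 * r ^ n * (\<bar>Re (x s)\<bar> + (cmod (x s))\<^sup>2)"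
        using abs_Re_one_minus_power_le[of r "x s" n] rest Mr by (fastforce simp: P_def)
      then have "g n s \<le> m s * ((real n)\<^sup>2 * r ^ n * (\<bar>Re (x s)\<bar> + (cmod (x s))\<^sup>2))"
        unfolding g_def using m[of s] s by (intro mult_left_mono) auto
      then show "g n s \<le> (real n)\<^sup>2 * r ^ n * k s"
        by (simp add: k_def mult_ac)
    qed
    also have "\<dots> = (real n)\<^sup>2 * r ^ n * A"
      unfolding A_def using kR by (intro infsum_cmult_right) auto
    finally show ?thesis by (simp add: mult_ac)
  qed
  obtain c where c: "\<And>n. n \<ge> 1 \<Longrightarrow> infsum (g n) S \<ge> - c * r ^ n"
  proof -
    \<comment> \<open>At rate \<open>\<epsilon> = ln r\<close> the assumed lower bound is \<open>- c * r ^ n\<close>.\<close>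
    obtain c where "\<forall>n\<ge>1. infsum (g n) S \<ge> - c * exp (ln r * real n)"
      using lower[of "ln r"] Mr by (auto simp: g_def)
    moreover have "exp (ln r * real n) = r ^ n" for n
      using Mr by (simp add: exp_of_nat2_mult)
    ultimately show thesis using that by auto
  qed
  obtain N where N: "\<And>n. n \<ge> N \<Longrightarrow> W + (A * (real n)\<^sup>2 + c) * r ^ n < W * M ^ n / 2"
    using eventually_exponential_dominates[OF Mr W, of A c]
    unfolding eventually_sequentially by blast
  obtain n where n: "n \<ge> max 1 N"
    and top: "\<And>z. z \<in> (\<lambda>s. 1 + x s) ` P \<Longrightarrow> Re (z ^ n) \<ge> cmod z ^ n / 2"
    using simultaneous_powers_near_positive_axis[of "(\<lambda>s. 1 + x s) ` P" "max 1 N"] finP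
    by (auto simp: P_def)
  have "sum (g n) P \<le> (\<Sum>s\<in>P. m s * (1 - M ^ n / 2))"
    unfolding g_def
  proof (intro sum_mono mult_left_mono)
    fix s assume s: "s \<in> P"
    then show "Re (1 - (1 + x s) ^ n) \<le> 1 - M ^ n / 2"
      using top[of "1 + x s"] by (auto simp: P_def)
    show "0 \<le> m s" using m[of s] s by (simp add: P_def)
  qed
  then have "sum (g n) P \<le> W * (1 - M ^ n / 2)"
    by (simp add: W_def sum_distrib_right)
  also have "\<dots> = W - W * M ^ n / 2"
    by (simp add: right_diff_distrib)
  finally have "infsum (g n) S \<le> W - W * M ^ n / 2 + A * (real n)\<^sup>2 * r ^ n"
    using split[of n] tail[of n] by linarith
  also have "\<dots> < - c * r ^ n"
    using N[of n] n by (simp add: distrib_right)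
  finally show False
    using c[of n] n by linarith
qed

section \<open>The half plane and the unit disc\<close>

text \<open>
  \<open>\<bar>\<rho> - a\<bar>\<^sup>2 - \<bar>\<rho> - (2 \<sigma> - a)\<bar>\<^sup>2 = 4 (\<sigma> - a) (Re \<rho> - \<sigma>)\<close>, since \<open>\<sigma>\<close> is the midpoint of \<open>a\<close> and \<open>2 \<sigma> - a\<close>.
\<close>

lemma norm_quotient_le_1_iff:
  fixes \<rho> :: complex and a \<sigma> :: real
  assumes "\<rho> \<noteq> complex_of_real (2 * \<sigma> - a)"
  shows "cmod ((\<rho> - of_real a) / (\<rho> - of_real (2 * \<sigma>) + of_real a)) \<le> 1
    \<longleftrightarrow> (\<sigma> - a) * (Re \<rho> - \<sigma>) \<le> 0"
proof -
  have ne: "\<rho> - of_real (2 * \<sigma>) + of_real a \<noteq> 0"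
    using assms by (auto simp: algebra_simps)
  have "cmod ((\<rho> - of_real a) / (\<rho> - of_real (2 * \<sigma>) + of_real a)) \<le> 1
    \<longleftrightarrow> cmod (\<rho> - of_real a) \<le> cmod (\<rho> - of_real (2 * \<sigma>) + of_real a)"
    using ne by (simp add: norm_divide divide_le_eq_1)
  also have "\<dots> \<longleftrightarrow> (cmod (\<rho> - of_real a))\<^sup>2 \<le> (cmod (\<rho> - of_real (2 * \<sigma>) + of_real a))\<^sup>2"
    by (simp add: power2_le_iff_abs_le)
  also have "\<dots> \<longleftrightarrow> (\<sigma> - a) * (Re \<rho> - \<sigma>) \<le> 0"
    unfolding cmod_power2 by (auto simp: power2_eq_square algebra_simps)
  finally show ?thesis .
qed

text \<open>
  The hypothesis bounds a sum of \<open>1 / (1 + \<bar>z\<bar>\<^sup>2)\<close>, with \<open>z = \<rho> - (2 \<sigma> - a)\<close>. This controls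
  \<open>1 / \<bar>z\<bar>\<^sup>2\<close> except at the finitely many \<open>\<rho>\<close> with \<open>\<bar>z\<bar> < 1\<close>.
\<close>

lemma msummable_inverse_square:
  fixes a \<sigma> :: real and R :: complex_mset
  assumes ii: "msummable R (\<lambda>\<rho>. (1 + \<bar>Re \<rho>\<bar>) / (1 + (cmod (\<rho> + of_real a - of_real (2 * \<sigma>)))\<^sup>2))"
  shows "msummable R (\<lambda>\<rho>. 1 / (cmod (\<rho> + of_real a - of_real (2 * \<sigma>)))\<^sup>2)"
proof -
  define S where "S = elems_of R"
  define z where "z = (\<lambda>\<rho>. cmod (\<rho> + of_real a - of_real (2 * \<sigma>)))"
  define h where "h = (\<lambda>\<rho>. real (R \<rho>) * ((1 + \<bar>Re \<rho>\<bar>) / (1 + (z \<rho>)\<^sup>2)))"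
  define F where "F = {\<rho>\<in>S. z \<rho> < 1}"
  have sh: "h summable_on S"
    using ii by (simp add: msummable_def S_def h_def z_def)
  have R1: "real (R \<rho>) \<ge> 1" if "\<rho> \<in> S" for \<rho>
    using that by (simp add: S_def elems_of_def)
  have finF: "finite F"
  proof (rule finite_subset)
    show "finite {\<rho>\<in>S. h \<rho> \<ge> 1 / 2}"
      by (rule finite_if_summable_on_bounded_below[OF sh]) (auto simp: h_def)
    show "F \<subseteq> {\<rho>\<in>S. h \<rho> \<ge> 1 / 2}"
    proof
      fix \<rho> assume \<rho>: "\<rho> \<in> F"
      then have "(z \<rho>)\<^sup>2 \<le> 1"
        by (simp add: F_def z_def power_le_one)
      then have "1 / 2 \<le> (1 + \<bar>Re \<rho>\<bar>) / (1 + (z \<rho>)\<^sup>2)"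
        by (intro frac_le) (auto intro: add_pos_nonneg)
      then have "1 * (1 / 2) \<le> h \<rho>"
        unfolding h_def using R1[of \<rho>] \<rho> by (intro mult_mono) (auto simp: F_def)
      then show "\<rho> \<in> {\<rho>\<in>S. h \<rho> \<ge> 1 / 2}"
        using \<rho> by (simp add: F_def)
    qed
  qed
  have "(\<lambda>\<rho>. real (R \<rho>) * (1 / (z \<rho>)\<^sup>2)) summable_on (S - F)"
  proof (rule summable_on_comparison_test)
    show "(\<lambda>\<rho>. 2 * h \<rho>) summable_on (S - F)"
      using sh by (intro summable_on_cmult_right) (auto intro: summable_on_subset_banach)
    fix \<rho> assume \<rho>: "\<rho> \<in> S - F"
    then have z1: "(z \<rho>)\<^sup>2 \<ge> 1"
      by (auto simp: F_def intro!: one_le_power)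
    then have "1 / (z \<rho>)\<^sup>2 \<le> 1 / ((1 + (z \<rho>)\<^sup>2) / 2)"
      by (intro divide_left_mono mult_pos_pos) auto
    also have "\<dots> \<le> 2 * ((1 + \<bar>Re \<rho>\<bar>) / (1 + (z \<rho>)\<^sup>2))"
      unfolding times_divide_eq_right by (simp, intro divide_right_mono) auto
    finally have "real (R \<rho>) * (1 / (z \<rho>)\<^sup>2)
        \<le> real (R \<rho>) * (2 * ((1 + \<bar>Re \<rho>\<bar>) / (1 + (z \<rho>)\<^sup>2)))"
      by (intro mult_left_mono) auto
    then show "real (R \<rho>) * (1 / (z \<rho>)\<^sup>2) \<le> 2 * h \<rho>"
      by (simp add: h_def algebra_simps)
  qed auto
  then have "(\<lambda>\<rho>. real (R \<rho>) * (1 / (z \<rho>)\<^sup>2)) summable_on ((S - F) \<union> F)"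
    using finF by (intro summable_on_Un_disjoint) auto
  moreover have "(S - F) \<union> F = S"
    by (auto simp: F_def)
  ultimately show ?thesis
    by (simp add: msummable_def S_def z_def)
qed

text \<open>
  The criterion for \<open>x = (2 \<sigma> - 2 a) / (\<rho> - 2 \<sigma> + a)\<close>. The sum of \<open>\<bar>Re x\<bar>\<close> is the case \<open>n = 1\<close>
  of the convergence of \<open>li_sum\<close>: a convergent unordered sum of reals converges absolutely.
\<close>

lemma norm_quotient_le_1_if_li_lower_bound:
  fixes a \<sigma> :: real and R :: complex_mset
  assumes i: "complex_of_real (2 * \<sigma> - a) \<notin> elems_of R"
    and ii: "msummable R
           (\<lambda>\<rho>. (1 + \<bar>Re \<rho>\<bar>) / (1 + (cmod (\<rho> + of_real a - of_real (2 * \<sigma>)))\<^sup>2))"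
    and lower: "\<forall>\<epsilon>>0. \<exists>c>0. \<forall>n\<ge>1. li_sum a \<sigma> R n \<ge> - c * exp (\<epsilon> * real n)"
    and \<rho>: "\<rho> \<in> elems_of R"
  shows "cmod ((\<rho> - of_real a) / (\<rho> - of_real (2 * \<sigma>) + of_real a)) \<le> 1"
proof -
  define S where "S = elems_of R"
  define x where "x = (\<lambda>\<rho>. complex_of_real (2 * \<sigma> - 2 * a) / (\<rho> + of_real a - of_real (2 * \<sigma>)))"
  have q: "(\<rho> - of_real a) / (\<rho> - of_real (2 * \<sigma>) + of_real a) = 1 + x \<rho>" if "\<rho> \<in> S" for \<rho>
  proof -
    have "\<rho> + of_real a - of_real (2 * \<sigma>) \<noteq> 0"
      using i that by (auto simp: S_def eq_diff_eq[symmetric])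
    then show ?thesis
      by (simp add: x_def field_simps)
  qed
  have terms: "(\<lambda>\<rho>. real (R \<rho>) * Re (1 - (1 + x \<rho>) ^ n)) summable_on S" for n
    using li_sum_summable[OF ii, of n] unfolding msummable_def S_def[symmetric]
    by (rule summable_on_cong[THEN iffD1, rotated]) (simp only: q)
  have li: "li_sum a \<sigma> R n = (\<Sum>\<^sub>\<infinity>\<rho>\<in>S. real (R \<rho>) * Re (1 - (1 + x \<rho>) ^ n))" for n
    unfolding li_sum_def msum_def S_def[symmetric] by (rule infsum_cong) (simp only: q)
  have "(\<lambda>\<rho>. \<bar>real (R \<rho>) * Re (1 - (1 + x \<rho>) ^ 1)\<bar>) summable_on S"
    using summable_on_iff_abs_summable_on_real[THEN iffD1, OF terms[of 1]]
    by (simp only: real_norm_def)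
  then have re: "(\<lambda>\<rho>. real (R \<rho>) * \<bar>Re (x \<rho>)\<bar>) summable_on S"
    by (simp add: abs_mult)
  have "(cmod (x \<rho>))\<^sup>2 = (2 * \<sigma> - 2 * a)\<^sup>2 * (1 / (cmod (\<rho> + of_real a - of_real (2 * \<sigma>)))\<^sup>2)" for \<rho>
    unfolding x_def norm_divide norm_of_real by (simp add: power_divide)
  then have "(\<lambda>\<rho>. real (R \<rho>) * (cmod (x \<rho>))\<^sup>2) summable_on S"
    using summable_on_cmult_right[OF msummable_inverse_square[OF ii, unfolded msummable_def],
        of "(2 * \<sigma> - 2 * a)\<^sup>2"]
    by (simp add: S_def mult_ac)
  with re have "(\<lambda>\<rho>. real (R \<rho>) * (\<bar>Re (x \<rho>)\<bar> + (cmod (x \<rho>))\<^sup>2)) summable_on S"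
    unfolding distrib_left by (rule summable_on_add)
  then have "cmod (1 + x \<rho>) \<le> 1"
  proof (rule norm_le_1_if_li_lower_bound[rotated])
    show "\<rho> \<in> S" using \<rho> by (simp add: S_def)
    show "real (R s) \<ge> 1" if "s \<in> S" for s
      using that by (simp add: S_def elems_of_def)
  qed (use lower terms in \<open>auto simp: li\<close>)
  then show ?thesis
    using q[of \<rho>] \<rho> by (simp only: S_def)
qed

lemma li_sum_nonneg:
  assumes "\<And>\<rho>. \<rho> \<in> elems_of R \<Longrightarrow>
    cmod ((\<rho> - of_real a) / (\<rho> - of_real (2 * \<sigma>) + of_real a)) \<le> 1"
  shows "li_sum a \<sigma> R n \<ge> 0"
  unfolding li_sum_def msum_def
proof (intro infsum_nonneg mult_nonneg_nonneg)
  fix \<rho> assume \<rho>: "\<rho> \<in> elems_of R"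
  define u where "u = (\<rho> - of_real a) / (\<rho> - of_real (2 * \<sigma>) + of_real a)"
  have "Re (u ^ n) \<le> cmod u ^ n"
    using complex_Re_le_cmod[of "u ^ n"] by (simp add: norm_power)
  also have "\<dots> \<le> 1"
    using assms[OF \<rho>] by (intro power_le_one) (auto simp: u_def)
  finally show "0 \<le> Re (1 - ((\<rho> - of_real a) / (\<rho> - of_real (2 * \<sigma>) + of_real a)) ^ n)"
    by (simp add: u_def)
qed simp

theorem theorem2:
  fixes a \<sigma> :: real and R :: complex_mset
  assumes "complex_of_real (2 * \<sigma> - a) \<notin> elems_of R"
    and "msummable R
           (\<lambda>\<rho>. (1 + \<bar>Re \<rho>\<bar>) / (1 + (cmod (\<rho> + of_real a - of_real (2 * \<sigma>)))\<^sup>2))"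
  shows
    "(a < \<sigma> \<longrightarrow>
       ((\<forall>\<rho>\<in>elems_of R. Re \<rho> \<le> \<sigma>) \<longleftrightarrow> (\<forall>n\<ge>1. li_sum a \<sigma> R n \<ge> 0)) \<and>
       ((\<forall>n\<ge>1. li_sum a \<sigma> R n \<ge> 0) \<longleftrightarrow>
        (\<forall>\<epsilon>>0. \<exists>c>0. \<forall>n\<ge>1. li_sum a \<sigma> R n \<ge> - c * exp (\<epsilon> * real n)))) \<and>
     (a > \<sigma> \<longrightarrow>
       ((\<forall>\<rho>\<in>elems_of R. Re \<rho> \<ge> \<sigma>) \<longleftrightarrow> (\<forall>n\<ge>1. li_sum a \<sigma> R n \<ge> 0)) \<and>
       ((\<forall>n\<ge>1. li_sum a \<sigma> R n \<ge> 0) \<longleftrightarrow>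
        (\<forall>\<epsilon>>0. \<exists>c>0. \<forall>n\<ge>1. li_sum a \<sigma> R n \<ge> - c * exp (\<epsilon> * real n))))"
proof -
  let ?disc = "\<forall>\<rho>\<in>elems_of R. cmod ((\<rho> - of_real a) / (\<rho> - of_real (2 * \<sigma>) + of_real a)) \<le> 1"
  let ?nonneg = "\<forall>n\<ge>1. li_sum a \<sigma> R n \<ge> 0"
  let ?lower = "\<forall>\<epsilon>>0. \<exists>c>0. \<forall>n\<ge>1. li_sum a \<sigma> R n \<ge> - c * exp (\<epsilon> * real n)"
  have "?disc \<longrightarrow> ?nonneg"
    by (auto intro: li_sum_nonneg)
  moreover have "?nonneg \<longrightarrow> ?lower"
    by (intro impI allI exI[of _ 1] conjI) (auto intro: order_trans[of _ 0])
  moreover have "?lower \<longrightarrow> ?disc"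
    using norm_quotient_le_1_if_li_lower_bound[OF assms] by blast
  ultimately have equiv: "?disc \<longleftrightarrow> ?nonneg" "?nonneg \<longleftrightarrow> ?lower"
    by blast+
  have disc: "?disc \<longleftrightarrow> (\<forall>\<rho>\<in>elems_of R. (\<sigma> - a) * (Re \<rho> - \<sigma>) \<le> 0)"
  proof (rule ball_cong[OF refl])
    fix \<rho> assume "\<rho> \<in> elems_of R"
    then have "\<rho> \<noteq> complex_of_real (2 * \<sigma> - a)" using assms(1) by auto
    then show "cmod ((\<rho> - of_real a) / (\<rho> - of_real (2 * \<sigma>) + of_real a)) \<le> 1
        \<longleftrightarrow> (\<sigma> - a) * (Re \<rho> - \<sigma>) \<le> 0"
      by (rule norm_quotient_le_1_iff)
  qed
  show ?thesis
  proof (intro conjI impI)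
    show "(\<forall>\<rho>\<in>elems_of R. Re \<rho> \<le> \<sigma>) \<longleftrightarrow> ?nonneg" if "a < \<sigma>"
      unfolding equiv(1)[symmetric] disc using that by (simp add: mult_le_0_iff)
    show "(\<forall>\<rho>\<in>elems_of R. Re \<rho> \<ge> \<sigma>) \<longleftrightarrow> ?nonneg" if "a > \<sigma>"
      unfolding equiv(1)[symmetric] disc using that by (simp add: mult_le_0_iff)
  qed (rule equiv(2))+
qed

end
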